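(* Let $H$ be a complex Hilbert space, let $A\in\mathcal{B}(H)$ be positive, and let $T$ and $S$ be densely defined closable linear operators on $H$. Suppose that $\mathcal{R}(T^*A)\subseteq\mathcal{R}(A)$ and $\mathcal{R}(S^*A)\subseteq\mathcal{R}(A)$. Then: (1) If $(T+S)^{\#}$ exists, then $T^{\#}+S^{\#}\subseteq(T+S)^{\#}$. (2) If $S$ is bounded, then $(T+S)^{\#}=T^{\#}+S^{\#}$.
   Context: Inner products are linear in the first variable. For a positive bounded operator $A$ on $H$, $\langle f,g\rangle_A=\langle Af,g\rangle$. $\mathcal{D}(\cdot)$ and $\mathcal{R}(\cdot)$ denote domain and range; $T^*$ is the Hilbert-space adjoint. Sums and products of operators have their natural domains, and $S\subseteq T$ means that $T$ extends $S$. $A$-adjoint: let $T:\mathcal{D}(T)\subseteq H\to H$ be densely defined and closable with $\mathcal{R}(T^*A)\subseteq\mathcal{R}(A)$ (in this case one says $T^{\#}$ exists). The $A$-adjoint $T^{\#}$ has domain the set of $f\in H$ for which there is a unique $g_f\in\overline{\mathcal{R}(A)}$ with $\langle Th,f\rangle_A=\langle h,g_f\rangle_A$ for every $h\in\mathcal{D}(T)$, and $T^{\#}f=g_f$. It is the unique operator with $AT^{\#}=T^*A$ (equality including domains) and $\mathcal{R}(T^{\#})\subseteq\overline{\mathcal{R}(A)}$. *)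

theory Defs
  imports "HOL-Analysis.Analysis"
begin

section \<open>Complex Hilbert spaces\<close>

text \<open>The inner product is linear in the \<^emph>\<open>first\<close> variable. Norm, metric, topology and
  real scalar multiplication come from the superclass and are tied to the complex structure by
  \<open>norm_eq_sqrt_cinner\<close> and \<open>scaleR_scaleC\<close>.\<close>

class complex_inner = real_normed_vector +
  fixes scaleC :: "complex \<Rightarrow> 'a \<Rightarrow> 'a"  (infixr \<open>*\<^sub>C\<close> 75)
    and cinner :: "'a \<Rightarrow> 'a \<Rightarrow> complex"
  assumes scaleC_add_right: "c *\<^sub>C (x + y) = c *\<^sub>C x + c *\<^sub>C y"
    and scaleC_add_left: "(c + d) *\<^sub>C x = c *\<^sub>C x + d *\<^sub>C x"
    and scaleC_scaleC: "c *\<^sub>C (d *\<^sub>C x) = (c * d) *\<^sub>C x"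
    and scaleR_scaleC: "scaleR r x = complex_of_real r *\<^sub>C x"
    and cinner_commute: "cinner x y = cnj (cinner y x)"
    and cinner_add_left: "cinner (x + y) z = cinner x z + cinner y z"
    and cinner_scaleC_left: "cinner (c *\<^sub>C x) y = c * cinner x y"
    and cinner_self_nonneg: "cinner x x \<in> \<real>\<^sub>\<ge>\<^sub>0"
    and cinner_eq_zero_iff: "cinner x x = 0 \<longleftrightarrow> x = 0"
    and norm_eq_sqrt_cinner: "norm x = sqrt (cmod (cinner x x))"

class chilbert_space = complex_inner + complete_space

global_interpretation complex_vector:
  vector_space "scaleC :: complex \<Rightarrow> 'a \<Rightarrow> 'a::complex_inner"
proof unfold_locales
  fix x :: 'a
  show "1 *\<^sub>C x = x"
    using scaleR_scaleC[of 1 x] by simp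
qed (simp_all add: scaleC_add_right scaleC_add_left scaleC_scaleC)

instantiation complex :: chilbert_space
begin

definition scaleC_complex :: "complex \<Rightarrow> complex \<Rightarrow> complex" where
  "scaleC_complex c x = c * x"

definition cinner_complex :: "complex \<Rightarrow> complex \<Rightarrow> complex" where
  "cinner_complex x y = x * cnj y"

instance
proof
  fix x :: complex
  show "cinner x x \<in> \<real>\<^sub>\<ge>\<^sub>0"
    unfolding cinner_complex_def complex_mult_cnj by (subst nonneg_Reals_of_real_iff) simp
  show "norm x = sqrt (cmod (cinner x x))"
    by (simp add: cinner_complex_def norm_mult)
qed (simp_all add: scaleC_complex_def cinner_complex_def algebra_simps scaleR_conv_of_real)

end


section \<open>Bounded operators\<close>

definition bounded_clinear :: "('a::complex_inner \<Rightarrow> 'a) \<Rightarrow> bool" where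
  "bounded_clinear A \<longleftrightarrow>
     Vector_Spaces.linear scaleC scaleC A \<and> (\<exists>K. \<forall>x. norm (A x) \<le> K * norm x)"

definition positive_op :: "('a::complex_inner \<Rightarrow> 'a) \<Rightarrow> bool" where
  "positive_op A \<longleftrightarrow> (\<forall>f. cinner (A f) f \<in> \<real>\<^sub>\<ge>\<^sub>0)"

definition cinner_wrt :: "('a::complex_inner \<Rightarrow> 'a) \<Rightarrow> 'a \<Rightarrow> 'a \<Rightarrow> complex" where
  "cinner_wrt A f g = cinner (A f) g"


section \<open>Operators with a domain\<close>

text \<open>A possibly unbounded operator is a partial function \<open>T :: 'a \<rightharpoonup> 'a\<close>. Its domain
  and range are \<open>dom T\<close> and \<open>ran T\<close>, the product with natural domain is \<open>\<circ>\<^sub>m\<close>, the relation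
  ``\<open>T\<close> extends \<open>S\<close>'' is \<open>S \<subseteq>\<^sub>m T\<close>, and \<open>S = T\<close> includes equality of domains.
  An everywhere defined operator \<open>A :: 'a \<Rightarrow> 'a\<close> is regarded as such an operator via
  \<open>Some \<circ> A\<close>.\<close>

definition linear_op :: "('a::complex_inner \<rightharpoonup> 'a) \<Rightarrow> bool" where
  "linear_op T \<longleftrightarrow>
     T 0 = Some 0 \<and>
     (\<forall>x y u v. T x = Some u \<longrightarrow> T y = Some v \<longrightarrow> T (x + y) = Some (u + v)) \<and>
     (\<forall>c x u. T x = Some u \<longrightarrow> T (c *\<^sub>C x) = Some (c *\<^sub>C u))"

definition densely_defined :: "('a::complex_inner \<rightharpoonup> 'a) \<Rightarrow> bool" where
  "densely_defined T \<longleftrightarrow> closure (dom T) = UNIV"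

definition closed_op :: "('a::complex_inner \<rightharpoonup> 'a) \<Rightarrow> bool" where
  "closed_op T \<longleftrightarrow> closed (Map.graph T)"

definition closable_op :: "('a::complex_inner \<rightharpoonup> 'a) \<Rightarrow> bool" where
  "closable_op T \<longleftrightarrow> (\<exists>S. linear_op S \<and> closed_op S \<and> T \<subseteq>\<^sub>m S)"

text \<open>Bounded means belonging to \<open>B(H)\<close>; in particular the domain is the whole space.\<close>

definition bounded_op :: "('a::complex_inner \<rightharpoonup> 'a) \<Rightarrow> bool" where
  "bounded_op T \<longleftrightarrow> (\<exists>B. bounded_clinear B \<and> T = Some \<circ> B)"

definition op_add :: "('a::complex_inner \<rightharpoonup> 'a) \<Rightarrow> ('a \<rightharpoonup> 'a) \<Rightarrow> ('a \<rightharpoonup> 'a)"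
    (infixl \<open>+\<^sub>o\<^sub>p\<close> 65) where
  "T +\<^sub>o\<^sub>p S =
     (\<lambda>x. if x \<in> dom T \<inter> dom S then Some (the (T x) + the (S x)) else None)"


section \<open>The Hilbert-space adjoint and the A-adjoint\<close>

text \<open>For densely defined \<open>T\<close> the vector \<open>g\<close> is unique as soon as it exists.\<close>

definition adjoint_op :: "('a::complex_inner \<rightharpoonup> 'a) \<Rightarrow> ('a \<rightharpoonup> 'a)" where
  "adjoint_op T =
     (\<lambda>f. if \<exists>!g. \<forall>h\<in>dom T. cinner (the (T h)) f = cinner h g
           then Some (THE g. \<forall>h\<in>dom T. cinner (the (T h)) f = cinner h g)
           else None)"

definition A_adjoint_exists :: "('a::complex_inner \<Rightarrow> 'a) \<Rightarrow> ('a \<rightharpoonup> 'a) \<Rightarrow> bool" where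
  "A_adjoint_exists A T \<longleftrightarrow>
     densely_defined T \<and> closable_op T \<and>
     ran (adjoint_op T \<circ>\<^sub>m (Some \<circ> A)) \<subseteq> range A"

text \<open>Meaningful only when \<open>A_adjoint_exists A T\<close> holds.\<close>

definition A_adjoint :: "('a::complex_inner \<Rightarrow> 'a) \<Rightarrow> ('a \<rightharpoonup> 'a) \<Rightarrow> ('a \<rightharpoonup> 'a)" where
  "A_adjoint A T =
     (\<lambda>f. if \<exists>!g. g \<in> closure (range A) \<and>
                 (\<forall>h\<in>dom T. cinner_wrt A (the (T h)) f = cinner_wrt A h g)
           then Some (THE g. g \<in> closure (range A) \<and>
                 (\<forall>h\<in>dom T. cinner_wrt A (the (T h)) f = cinner_wrt A h g))
           else None)"

end

theory Submission
  imports Defs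
begin

text \<open>Since \<open>A\<close> is symmetric, \<open>g \<in> closure (range A)\<close> is determined by the values
  \<open>\<langle>A h, g\<rangle> = \<langle>h, A g\<rangle>\<close> for \<open>h\<close> in a dense set: the kernel of \<open>A\<close> is orthogonal to the range.
  Hence adding the two defining identities of \<open>T\<^sup>#\<close> and \<open>S\<^sup>#\<close> gives (1).
  For (2), \<open>S\<^sup>*\<close> is everywhere defined by Riesz, so \<open>S\<^sup>*A f = A u\<close> for some \<open>u\<close>, and projecting
  \<open>u\<close> onto \<open>closure (range A)\<close> shows that \<open>S\<^sup>#\<close> is everywhere defined; the two identities can then be
  subtracted. Riesz representation and orthogonal projection are both instances of minimising
  \<open>\<parallel>m\<parallel>\<^sup>2 - 2 Re \<phi>(m)\<close> over a closed subspace.\<close>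

section \<open>Inner products\<close>

lemma cinner_add_right: "cinner x (y + z) = cinner x y + cinner x (z::'a::complex_inner)"
  by (metis cinner_add_left cinner_commute complex_cnj_add)

lemma cinner_scaleC_right: "cinner x (c *\<^sub>C y) = cnj c * cinner x (y::'a::complex_inner)"
  by (metis cinner_commute cinner_scaleC_left complex_cnj_mult)

lemma cinner_diff_left: "cinner (x - y) z = cinner x z - cinner y (z::'a::complex_inner)"
  by (metis add_diff_cancel cinner_add_left diff_add_cancel)

lemma cinner_diff_right: "cinner x (y - z) = cinner x y - cinner x (z::'a::complex_inner)"
  by (metis add_diff_cancel cinner_add_right diff_add_cancel)

lemma cinner_zero_right [simp]: "cinner (x::'a::complex_inner) 0 = 0"
  using cinner_diff_right[of x x x] by simp

lemma cinner_self: "cinner x x = complex_of_real ((norm (x::'a::complex_inner))\<^sup>2)"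
proof -
  obtain r where r: "cinner x x = complex_of_real r" "r \<ge> 0"
    using cinner_self_nonneg[of x] by (auto elim: nonneg_Reals_cases)
  then show ?thesis by (simp add: norm_eq_sqrt_cinner[of x])
qed

lemma norm_scaleC: "norm (c *\<^sub>C x) = cmod c * norm (x::'a::complex_inner)"
  by (simp add: norm_eq_sqrt_cinner[of x] norm_eq_sqrt_cinner[of "c *\<^sub>C x"]
      cinner_scaleC_left cinner_scaleC_right norm_mult
      real_sqrt_mult mult.assoc[symmetric])

lemma norm_add_squared:
  "(norm (x + y))\<^sup>2 = (norm x)\<^sup>2 + 2 * Re (cinner x y) + (norm (y::'a::complex_inner))\<^sup>2"
proof -
  have "complex_of_real ((norm (x + y))\<^sup>2)
      = complex_of_real ((norm x)\<^sup>2) + cinner x y + cnj (cinner x y) + complex_of_real ((norm y)\<^sup>2)"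
    unfolding cinner_self[symmetric] cinner_commute[of y x, symmetric]
    by (simp add: cinner_add_left cinner_add_right)
  from arg_cong[OF this, of Re] show ?thesis by simp
qed

lemma cinner_Cauchy_Schwarz: "cmod (cinner x y) \<le> norm x * norm (y::'a::complex_inner)"
proof (cases "y = 0")
  case False
  define n where "n = (norm y)\<^sup>2"
  have n: "n > 0" using False by (simp add: n_def)
  \<comment> \<open>This \<open>c\<close> makes \<open>x + c *\<^sub>C y\<close> orthogonal to
    \<open>y\<close>, so it minimises the norm; that the minimum is nonnegative is the
    claim.\<close>
  define c where "c = - cinner x y / complex_of_real n"
  have "0 \<le> (norm (x + c *\<^sub>C y))\<^sup>2" by simp
  also have "\<dots> = (norm x)\<^sup>2 + 2 * Re (cnj c * cinner x y) + (cmod c)\<^sup>2 * n"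
    by (simp add: norm_add_squared cinner_scaleC_right norm_scaleC power_mult_distrib n_def)
  also have "cnj c * cinner x y = complex_of_real (- ((cmod (cinner x y))\<^sup>2 / n))"
    by (simp add: c_def complex_norm_square mult.commute del: of_real_power)
  also have "(cmod c)\<^sup>2 * n = (cmod (cinner x y))\<^sup>2 / n"
    using n by (simp add: c_def norm_divide power_divide power2_eq_square)
  finally have "(cmod (cinner x y))\<^sup>2 / n \<le> (norm x)\<^sup>2" by simp
  then have "(cmod (cinner x y))\<^sup>2 \<le> (norm x * norm y)\<^sup>2"
    using n by (simp add: field_simps n_def)
  then show ?thesis by (rule power2_le_imp_le) simp
qed simp

lemma bounded_linear_cinner_left: "bounded_linear (\<lambda>x::'a::complex_inner. cinner x y)"
proof (rule bounded_linear_intro[where K = "norm y"])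
  show "cinner (r *\<^sub>R x) y = r *\<^sub>R cinner x y" for r and x :: 'a
    unfolding scaleR_scaleC[of r x] scaleR_conv_of_real by (rule cinner_scaleC_left)
qed (rule cinner_add_left cinner_Cauchy_Schwarz)+

lemma cinner_zero_on_closure:
  fixes g :: "'a::complex_inner"
  assumes "x \<in> closure D" and "\<And>h. h \<in> D \<Longrightarrow> cinner h g = 0"
  shows "cinner x g = 0"
  by (rule continuous_constant_on_closure[of D "\<lambda>h. cinner h g" 0 x,
        OF linear_continuous_on[OF bounded_linear_cinner_left] assms(2,1)])

lemma cinner_dense_eqI:
  fixes g g' :: "'a::complex_inner"
  assumes "closure D = UNIV" and "\<And>h. h \<in> D \<Longrightarrow> cinner h g = cinner h g'"
  shows "g = g'"
proof -
  have "cinner (g - g') (g - g') = 0"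
    by (rule cinner_zero_on_closure[of _ D]) (use assms in \<open>auto simp: cinner_diff_right\<close>)
  then show ?thesis by (simp add: cinner_eq_zero_iff)
qed


section \<open>Riesz representation\<close>

text \<open>If \<open>g\<close> represents \<open>\<phi>\<close> on \<open>M\<close>, then
  \<open>J m\<close> below equals norm(m - g)^2 - norm(g)^2 there, so \<open>g\<close> must be its
  minimiser. Conversely, a minimiser is built from a minimising sequence, and the representation is
  its first-order condition.\<close>

lemma Riesz_closed_subspace:
  fixes M :: "'a::chilbert_space set" and \<phi> :: "'a \<Rightarrow> complex"
  assumes M: "complex_vector.subspace M" "closed M"
    and \<phi>: "bounded_linear \<phi>" and hom: "\<And>c x. \<phi> (c *\<^sub>C x) = c * \<phi> x"
  obtains g where "g \<in> M" and "\<And>m. m \<in> M \<Longrightarrow> \<phi> m = cinner m g"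
proof -
  interpret \<phi>: bounded_linear \<phi> by (rule \<phi>)
  define J where "J m = (norm m)\<^sup>2 - 2 * Re (\<phi> m)" for m
  define d where "d = (INF m\<in>M. J m)"
  obtain K where K: "\<And>x. cmod (\<phi> x) \<le> norm x * K"
    using \<phi>.bounded by blast
  \<comment> \<open>Completing the square in \<open>norm m\<close>.\<close>
  have below: "- K\<^sup>2 \<le> J m" for m
  proof -
    have "Re (\<phi> m) \<le> norm m * K"
      using complex_Re_le_cmod[of "\<phi> m"] K[of m] by linarith
    moreover have "0 \<le> (norm m - K)\<^sup>2" by simp
    ultimately show ?thesis by (simp add: J_def power2_diff)
  qed
  then have bdd: "bdd_below (J ` M)" by (intro bdd_belowI2)
  have d: "d \<le> J m" if "m \<in> M" for m
    unfolding d_def using bdd that by (rule cINF_lower)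
  have ne: "M \<noteq> {}" using M(1) complex_vector.subspace_0 by blast
  have "\<exists>m\<in>M. J m < d + 1 / real (Suc n)" for n
  proof (rule ccontr)
    assume "\<not> ?thesis"
    then have "d + 1 / real (Suc n) \<le> d"
      unfolding d_def using ne by (intro cINF_greatest) (auto simp: d_def not_less)
    then show False by simp
  qed
  then obtain s where s: "\<And>n. s n \<in> M" and sJ: "\<And>n. J (s n) < d + 1 / real (Suc n)"
    by metis
  \<comment> \<open>Parallelogram law: with the midpoint \<open>m\<close>, \<open>J a + J b\<close>
    is \<open>2 * J m\<close> plus half of norm(a - b)^2, and \<open>J m\<close> is at least
    \<open>d\<close>. Hence near-minimisers are close together.\<close>
  have dist: "(norm (a - b))\<^sup>2 \<le> 2 * (J a - d) + 2 * (J b - d)" if "a \<in> M" "b \<in> M" for a b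
  proof -
    define m where "m = (1/2) *\<^sub>R (a + b)"
    have "m \<in> M" unfolding m_def scaleR_scaleC
      using M(1) that by (intro complex_vector.subspace_scale complex_vector.subspace_add)
    then have "d \<le> J m" by (rule d)
    moreover have "(norm (a - b))\<^sup>2 = (norm a)\<^sup>2 - 2 * Re (cinner a b) + (norm b)\<^sup>2"
      using norm_add_squared[of "a - b" b]
      by (simp add: cinner_diff_left cinner_self)
    moreover have "J m = (norm (a + b))\<^sup>2 / 4 - Re (\<phi> a) - Re (\<phi> b)"
      by (simp add: J_def m_def \<phi>.scaleR \<phi>.add power_divide add_divide_distrib)
    ultimately show ?thesis unfolding J_def norm_add_squared by (simp add: field_simps)
  qed
  have "Cauchy s"
  proof (rule metric_CauchyI)
    fix e :: real assume e: "e > 0"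
    obtain N where N: "4 / e\<^sup>2 < real N" using reals_Archimedean2 by blast
    have small: "2 * (J (s n) - d) < e\<^sup>2 / 2" if "n \<ge> N" for n
    proof -
      have "4 / e\<^sup>2 < real (Suc n)" using N that by linarith
      then have "1 / real (Suc n) < e\<^sup>2 / 4" using e by (simp add: field_simps)
      from order.strict_trans[OF sJ[of n] add_strict_left_mono[OF this]]
      show ?thesis by (simp add: field_simps)
    qed
    have "dist (s m) (s n) < e" if "m \<ge> N" "n \<ge> N" for m n
    proof -
      have "(norm (s m - s n))\<^sup>2 < e\<^sup>2"
        using dist[OF s s, of m n] small[OF that(1)] small[OF that(2)] by linarith
      then show ?thesis using e by (simp add: dist_norm power2_less_imp_less)
    qed
    then show "\<exists>N. \<forall>m\<ge>N. \<forall>n\<ge>N. dist (s m) (s n) < e" by blast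
  qed
  then obtain g where g: "s \<longlonglongrightarrow> g"
    using Cauchy_convergent convergent_def by blast
  have gM: "g \<in> M" using M(2) s g closed_sequentially by blast
  have "(\<lambda>n. J (s n)) \<longlonglongrightarrow> J g"
    unfolding J_def by (intro tendsto_intros \<phi>.tendsto g)
  moreover have "(\<lambda>n. d + 1 / real (Suc n)) \<longlonglongrightarrow> d + 0"
    using LIMSEQ_inverse_real_of_nat by (intro tendsto_intros) (simp add: inverse_eq_divide)
  ultimately have "J g \<le> d + 0"
    by (rule LIMSEQ_le) (use sJ in \<open>auto intro: less_imp_le\<close>)
  then have min: "J g \<le> J m" if "m \<in> M" for m using d[OF that] by linarith
  have "\<phi> m = cinner m g" if m: "m \<in> M" for m
  proof (rule ccontr)
    assume neq: "\<phi> m \<noteq> cinner m g"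
    \<comment> \<open>Perturb \<open>g\<close> along \<open>m\<close>. The factor
      \<open>cnj z\<close> makes the first-order change of \<open>J\<close> real and negative,
      -2t|z|^2. The second-order term is t^2 |z|^2 norm(m)^2, which the choice of \<open>t\<close>
      keeps below t|z|^2; the summand 1 in its denominator covers \<open>m = 0\<close>.\<close>
    define z where "z = \<phi> m - cinner m g"
    define t where "t = 1 / (1 + (norm m)\<^sup>2)"
    define c where "c = complex_of_real t * cnj z"
    have p: "1 + (norm m)\<^sup>2 > 0" by (simp add: add_pos_nonneg)
    then have t: "t > 0" by (simp add: t_def)
    have tm: "t * (norm m)\<^sup>2 < 1" using p by (simp add: t_def field_simps)
    have z0: "(cmod z)\<^sup>2 > 0" using neq by (simp add: z_def)
    have "g + c *\<^sub>C m \<in> M"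
      using M(1) gM m by (intro complex_vector.subspace_add complex_vector.subspace_scale)
    from min[OF this] have "J g \<le> J (g + c *\<^sub>C m)" .
    also have "\<dots> = J g + 2 * Re (cinner g (c *\<^sub>C m)) - 2 * Re (c * \<phi> m) + (cmod c)\<^sup>2 * (norm m)\<^sup>2"
      by (simp add: J_def norm_add_squared \<phi>.add hom norm_scaleC power_mult_distrib)
    also have "cinner g (c *\<^sub>C m) = cnj (c * cinner m g)"
      by (subst cinner_commute) (simp add: cinner_scaleC_left)
    also have "J g + 2 * Re (cnj (c * cinner m g)) - 2 * Re (c * \<phi> m) = J g - 2 * Re (c * z)"
      by (simp add: z_def algebra_simps)
    also have "c * z = complex_of_real (t * (cmod z)\<^sup>2)"
      by (simp add: c_def complex_norm_square mult.commute del: of_real_power)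
    also have "(cmod c)\<^sup>2 = t\<^sup>2 * (cmod z)\<^sup>2"
      by (simp add: c_def norm_mult power_mult_distrib)
    finally have "2 * (t * (cmod z)\<^sup>2) \<le> t * (cmod z)\<^sup>2 * (t * (norm m)\<^sup>2)"
      by (simp add: power2_eq_square mult_ac)
    also have "\<dots> < t * (cmod z)\<^sup>2 * 1"
      using t z0 tm by (intro mult_strict_left_mono) auto
    finally show False using t z0 by (simp add: mult_less_0_iff)
  qed
  then show ?thesis using gM that by blast
qed


section \<open>Bounded and positive operators\<close>

lemma bounded_clinear_props:
  assumes "bounded_clinear B"
  shows bounded_clinear_add: "B (x + y) = B x + B y"
    and bounded_clinear_scaleC: "B (c *\<^sub>C x) = c *\<^sub>C B x"
    and bounded_clinear_bounded_linear: "bounded_linear B"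
proof -
  interpret B: Vector_Spaces.linear scaleC scaleC B
    using assms by (simp add: bounded_clinear_def)
  obtain K where K: "\<And>x. norm (B x) \<le> K * norm x"
    using assms by (auto simp: bounded_clinear_def)
  show "B (x + y) = B x + B y" by (rule B.add)
  show "B (c *\<^sub>C x) = c *\<^sub>C B x" by (rule B.scale)
  show "bounded_linear B"
    by (rule bounded_linear_intro[where K = K])
      (use K in \<open>auto simp: B.add B.scale scaleR_scaleC mult.commute\<close>)
qed

lemma subspace_closure_range:
  fixes A :: "'a::complex_inner \<Rightarrow> 'a"
  assumes "bounded_clinear A"
  shows "complex_vector.subspace (closure (range A))"
proof -
  note add = bounded_clinear_add[OF assms] and scale = bounded_clinear_scaleC[OF assms]
  have "A 0 = 0" using add[of 0 0] by simp
  then have "0 \<in> closure (range A)" by (metis closure_subset rangeI subsetD)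
  moreover have "x + y \<in> closure (range A)"
    if xy: "x \<in> closure (range A)" "y \<in> closure (range A)" for x y
  proof -
    obtain s where s: "\<And>n. s n \<in> range A" "s \<longlonglongrightarrow> x"
      using xy(1) by (auto simp: closure_sequential)
    obtain t where t: "\<And>n. t n \<in> range A" "t \<longlonglongrightarrow> y"
      using xy(2) by (auto simp: closure_sequential)
    have "s n + t n \<in> range A" for n
      using s(1)[of n] t(1)[of n] by (elim rangeE) (simp flip: add)
    with tendsto_add[OF s(2) t(2)] show ?thesis
      unfolding closure_sequential by (intro exI[of _ "\<lambda>n. s n + t n"]) simp
  qed
  moreover have "c *\<^sub>C x \<in> closure (range A)" if x: "x \<in> closure (range A)" for c x
  proof -
    have "bounded_linear (\<lambda>x::'a. c *\<^sub>C x)"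
      by (rule bounded_linear_intro[where K = "cmod c"])
        (simp_all add: scaleC_add_right scaleR_scaleC scaleC_scaleC norm_scaleC mult.commute)
    note lim = bounded_linear.tendsto[OF this]
    obtain s where s: "\<And>n. s n \<in> range A" "s \<longlonglongrightarrow> x"
      using x by (auto simp: closure_sequential)
    have "c *\<^sub>C s n \<in> range A" for n
      using s(1)[of n] by (elim rangeE) (simp flip: scale)
    with lim[OF s(2)] show ?thesis
      unfolding closure_sequential by (intro exI[of _ "\<lambda>n. c *\<^sub>C s n"]) simp
  qed
  ultimately show ?thesis by (simp add: complex_vector.subspace_def)
qed

text \<open>Polarization; this is where complex scalars are needed.\<close>

lemma positive_op_symmetric:
  fixes A :: "'a::complex_inner \<Rightarrow> 'a"
  assumes A: "bounded_clinear A" "positive_op A"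
  shows "cinner (A x) y = cinner x (A y)"
proof -
  note simps = bounded_clinear_add[OF A(1)] bounded_clinear_scaleC[OF A(1)]
    cinner_add_left cinner_add_right cinner_scaleC_left cinner_scaleC_right
  have real: "Im (cinner (A f) f) = 0" for f
    using A(2) complex_nonneg_Reals_iff by (auto simp: positive_op_def)
  \<comment> \<open>Expanding the real-valued quadratic form at \<open>x + y\<close> controls
    imaginary parts; at \<open>\<i> *\<^sub>C x + y\<close> the factor \<open>\<i>\<close> turns
    real parts into imaginary ones.\<close>
  have "Im (cinner (A x) y + cinner (A y) x) = 0"
    using real[of "x + y"] real[of x] real[of y] by (simp add: simps)
  moreover have "Re (cinner (A x) y - cinner (A y) x) = 0"
    using real[of "\<i> *\<^sub>C x + y"] real[of x] real[of y] by (simp add: simps)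
  ultimately have "cinner (A x) y = cnj (cinner (A y) x)"
    by (simp add: complex_eq_iff)
  then show ?thesis by (simp add: cinner_commute[symmetric])
qed

text \<open>Riesz on the whole space; \<open>g\<close> is the adjoint of \<open>B\<close> applied to
  \<open>f\<close>.\<close>

lemma bounded_clinear_adjoint:
  fixes B :: "'a::chilbert_space \<Rightarrow> 'a"
  assumes "bounded_clinear B"
  obtains g where "\<And>h. cinner (B h) f = cinner h g"
proof (rule Riesz_closed_subspace[of UNIV "\<lambda>h. cinner (B h) f"])
  show "bounded_linear (\<lambda>h. cinner (B h) f)"
    using bounded_linear_compose[OF bounded_linear_cinner_left
        bounded_clinear_bounded_linear[OF assms]] .
qed (auto simp: bounded_clinear_scaleC[OF assms] cinner_scaleC_left intro: that)

text \<open>Take for \<open>v\<close> the orthogonal projection of \<open>u\<close>: the difference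
  is orthogonal to the range of \<open>A\<close>, hence killed by \<open>A\<close> by symmetry. This
  moves an arbitrary preimage to where values of an A-adjoint must lie.\<close>

lemma positive_op_preimage_in_closure_range:
  fixes A :: "'a::chilbert_space \<Rightarrow> 'a"
  assumes A: "bounded_clinear A" "positive_op A"
  obtains v where "v \<in> closure (range A)" and "A v = A u"
proof -
  obtain v where v: "v \<in> closure (range A)"
    and eq: "\<And>m. m \<in> closure (range A) \<Longrightarrow> cinner m u = cinner m v"
    by (rule Riesz_closed_subspace[of "closure (range A)" "\<lambda>m. cinner m u"])
      (auto simp: subspace_closure_range A(1) bounded_linear_cinner_left cinner_scaleC_left)
  have "A v = A u"
  proof (rule cinner_dense_eqI[OF closure_UNIV])
    show "cinner h (A v) = cinner h (A u)" for h
      using eq[OF closure_subset[THEN subsetD, OF rangeI, of A h]]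
      by (simp add: positive_op_symmetric[OF A])
  qed
  with v show ?thesis by (rule that)
qed


section \<open>Adjoints of densely defined operators\<close>

text \<open>Both adjoints are defined by this pattern; once uniqueness is known, each reduces to its
  defining identity.\<close>

lemma Some_the_eq_Some_iff:
  assumes "\<And>a b. P a \<Longrightarrow> P b \<Longrightarrow> a = b"
  shows "(if \<exists>!x. P x then Some (THE x. P x) else None) = Some y \<longleftrightarrow> P y"
proof
  assume "P y"
  then have "\<exists>!x. P x" and "(THE x. P x) = y"
    using assms by (blast intro: the_equality)+
  then show "(if \<exists>!x. P x then Some (THE x. P x) else None) = Some y" by simp
next
  assume "(if \<exists>!x. P x then Some (THE x. P x) else None) = Some y"
  then have "\<exists>!x. P x" and "y = (THE x. P x)"
    by (simp_all split: if_splits)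
  then show "P y" using theI'[of P] by simp
qed

lemma adjoint_op_eq_Some_iff:
  assumes "densely_defined T"
  shows "adjoint_op T f = Some g \<longleftrightarrow> (\<forall>h\<in>dom T. cinner (the (T h)) f = cinner h g)"
    (is "_ \<longleftrightarrow> ?P g")
proof -
  have "g1 = g2" if "?P g1" "?P g2" for g1 g2
    by (rule cinner_dense_eqI[of "dom T"]) (use assms that in \<open>auto simp: densely_defined_def\<close>)
  from Some_the_eq_Some_iff[of ?P, OF this] show ?thesis
    unfolding adjoint_op_def .
qed

text \<open>Uniqueness: by density two candidates have the same image under \<open>A\<close>, so
  their difference is orthogonal to the range of \<open>A\<close>. It also lies in the closure of
  that range, hence is orthogonal to itself.\<close>

lemma A_adjoint_eq_Some_iff:
  fixes A :: "'a::complex_inner \<Rightarrow> 'a"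
  assumes A: "bounded_clinear A" "positive_op A" and "densely_defined T"
  shows "A_adjoint A T f = Some g \<longleftrightarrow>
    g \<in> closure (range A) \<and> (\<forall>h\<in>dom T. cinner (A (the (T h))) f = cinner (A h) g)"
    (is "_ \<longleftrightarrow> ?P g")
proof -
  have "g1 = g2" if P: "?P g1" "?P g2" for g1 g2
  proof -
    have "A g1 = A g2"
      by (rule cinner_dense_eqI[of "dom T"])
        (use assms(3) P in
          \<open>auto simp: densely_defined_def positive_op_symmetric[OF A, symmetric]\<close>)
    then have "cinner (A h) (g1 - g2) = 0" for h
      by (simp add: cinner_diff_right positive_op_symmetric[OF A])
    moreover have "g1 - g2 \<in> closure (range A)"
      using P subspace_closure_range[OF A(1)] by (blast intro: complex_vector.subspace_diff)
    ultimately have "cinner (g1 - g2) (g1 - g2) = 0"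
      using cinner_zero_on_closure by (metis rangeE)
    then show ?thesis by (simp add: cinner_eq_zero_iff)
  qed
  from Some_the_eq_Some_iff[of ?P, OF this] show ?thesis
    unfolding A_adjoint_def cinner_wrt_def .
qed

section \<open>Sums of operators on their natural domain\<close>

lemma dom_op_add [simp]: "dom (T +\<^sub>o\<^sub>p S) = dom T \<inter> dom S"
  by (auto simp: op_add_def split: if_splits)

lemma op_add_apply: "h \<in> dom T \<inter> dom S \<Longrightarrow> the ((T +\<^sub>o\<^sub>p S) h) = the (T h) + the (S h)"
  by (simp add: op_add_def)

lemma op_add_eq_Some_iff:
  "(T +\<^sub>o\<^sub>p S) f = Some g \<longleftrightarrow> (\<exists>u v. T f = Some u \<and> S f = Some v \<and> g = u + v)"
  by (auto simp: op_add_def)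

lemma op_add_mono: "T \<subseteq>\<^sub>m T' \<Longrightarrow> T +\<^sub>o\<^sub>p S \<subseteq>\<^sub>m T' +\<^sub>o\<^sub>p S"
  by (auto simp: map_le_def op_add_def dom_def)

lemma linear_op_add: "linear_op T \<Longrightarrow> linear_op S \<Longrightarrow> linear_op (T +\<^sub>o\<^sub>p S)"
  unfolding linear_op_def op_add_eq_Some_iff
  by (auto simp: scaleC_add_right; metis add.assoc add.left_commute)

lemma closed_op_add_bounded:
  assumes T: "closed_op T" and B: "bounded_clinear B"
  shows "closed_op (T +\<^sub>o\<^sub>p (Some \<circ> B))"
proof -
  \<comment> \<open>The graph of the sum is the preimage of the graph of \<open>T\<close> under a
    continuous shear.\<close>
  have "Map.graph (T +\<^sub>o\<^sub>p (Some \<circ> B)) = (\<lambda>p. (fst p, snd p - B (fst p))) -` Map.graph T"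
    by (auto simp: Map.graph_def op_add_eq_Some_iff)
  moreover have "continuous_on UNIV (\<lambda>p. (fst p, snd p - B (fst p)))"
    by (intro continuous_intros
        bounded_linear.continuous_on[OF bounded_clinear_bounded_linear[OF B]])
  ultimately show ?thesis
    using T by (simp add: closed_op_def closed_vimage)
qed

lemma closable_op_add_bounded:
  assumes "closable_op T" and B: "bounded_clinear B"
  shows "closable_op (T +\<^sub>o\<^sub>p (Some \<circ> B))"
proof -
  obtain T' where T': "linear_op T'" "closed_op T'" "T \<subseteq>\<^sub>m T'"
    using assms(1) by (auto simp: closable_op_def)
  have "B 0 = 0" by (metis bounded_clinear_add[OF B] add_cancel_right_right)
  then have "linear_op (Some \<circ> B)"
    by (simp add: linear_op_def bounded_clinear_add[OF B] bounded_clinear_scaleC[OF B])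
  then show ?thesis
    unfolding closable_op_def
    using T' linear_op_add closed_op_add_bounded[OF _ B] op_add_mono by blast
qed

section \<open>A-adjoints of sums\<close>

lemma A_adjoint_op_add_le:
  fixes A :: "'a::complex_inner \<Rightarrow> 'a"
  assumes A: "bounded_clinear A" "positive_op A"
    and T: "densely_defined T" and S: "densely_defined S" and TS: "densely_defined (T +\<^sub>o\<^sub>p S)"
  shows "A_adjoint A T +\<^sub>o\<^sub>p A_adjoint A S \<subseteq>\<^sub>m A_adjoint A (T +\<^sub>o\<^sub>p S)"
proof -
  have "A_adjoint A (T +\<^sub>o\<^sub>p S) f = Some (u + v)"
    if "A_adjoint A T f = Some u" "A_adjoint A S f = Some v" for f u v
    using that subspace_closure_range[OF A(1)]
    unfolding A_adjoint_eq_Some_iff[OF A T] A_adjoint_eq_Some_iff[OF A S]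
      A_adjoint_eq_Some_iff[OF A TS]
    by (auto simp: op_add_apply bounded_clinear_add[OF A(1)] cinner_add_left cinner_add_right
        complex_vector.subspace_add)
  then show ?thesis by (auto simp: map_le_def op_add_eq_Some_iff)
qed

text \<open>Here \<open>v\<close> is the A-adjoint of \<open>B\<close> at \<open>f\<close>. The
  identity is stated with \<open>A f\<close> and \<open>A v\<close> so that it serves ordinary
  adjoints directly and A-adjoints after moving \<open>A\<close> across.\<close>

lemma A_adjoint_bounded_defined:
  fixes A B :: "'a::chilbert_space \<Rightarrow> 'a"
  assumes A: "bounded_clinear A" "positive_op A" and B: "bounded_clinear B"
    and ran: "ran (adjoint_op (Some \<circ> B) \<circ>\<^sub>m (Some \<circ> A)) \<subseteq> range A"
  obtains v where "v \<in> closure (range A)" and "\<And>h. cinner (B h) (A f) = cinner h (A v)"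
proof -
  have dense: "densely_defined (Some \<circ> B)"
    by (simp add: densely_defined_def dom_def)
  obtain w where w: "\<And>h. cinner (B h) (A f) = cinner h w"
    using bounded_clinear_adjoint[OF B, where f = "A f"] by blast
  then have "adjoint_op (Some \<circ> B) (A f) = Some w"
    by (simp add: adjoint_op_eq_Some_iff[OF dense])
  then have "(adjoint_op (Some \<circ> B) \<circ>\<^sub>m (Some \<circ> A)) f = Some w" by simp
  then have "w \<in> ran (adjoint_op (Some \<circ> B) \<circ>\<^sub>m (Some \<circ> A))" by (rule ranI)
  with ran obtain u where "w = A u" by blast
  then show ?thesis
    using positive_op_preimage_in_closure_range[OF A, of u] w that by metis
qed

theorem theorem3p11:
  fixes A :: "'a::chilbert_space \<Rightarrow> 'a"
    and T S :: "'a \<rightharpoonup> 'a"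
  assumes "bounded_clinear A" and "positive_op A"
    and "linear_op T" and "densely_defined T" and "closable_op T"
    and "linear_op S" and "densely_defined S" and "closable_op S"
    and "ran (adjoint_op T \<circ>\<^sub>m (Some \<circ> A)) \<subseteq> range A"
    and "ran (adjoint_op S \<circ>\<^sub>m (Some \<circ> A)) \<subseteq> range A"
  shows "(A_adjoint_exists A (T +\<^sub>o\<^sub>p S) \<longrightarrow>
            A_adjoint A T +\<^sub>o\<^sub>p A_adjoint A S \<subseteq>\<^sub>m A_adjoint A (T +\<^sub>o\<^sub>p S)) \<and>
         (bounded_op S \<longrightarrow>
            A_adjoint_exists A (T +\<^sub>o\<^sub>p S) \<and>
            A_adjoint A (T +\<^sub>o\<^sub>p S) = A_adjoint A T +\<^sub>o\<^sub>p A_adjoint A S)"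
proof (intro conjI impI)
  note A = assms(1,2)
  show "A_adjoint A T +\<^sub>o\<^sub>p A_adjoint A S \<subseteq>\<^sub>m A_adjoint A (T +\<^sub>o\<^sub>p S)"
    if "A_adjoint_exists A (T +\<^sub>o\<^sub>p S)"
    using A_adjoint_op_add_le[OF A assms(4,7)] that by (simp add: A_adjoint_exists_def)
  assume "bounded_op S"
  then obtain B where B: "bounded_clinear B" and S: "S = Some \<circ> B"
    by (auto simp: bounded_op_def)
  have dom: "dom (T +\<^sub>o\<^sub>p S) = dom T" by (auto simp: S)
  have TS: "densely_defined (T +\<^sub>o\<^sub>p S)"
    using assms(4) unfolding densely_defined_def dom .
  have add: "the ((T +\<^sub>o\<^sub>p S) h) = the (T h) + B h" if "h \<in> dom T" for h
    using that by (subst op_add_apply) (auto simp: S)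
  have "\<exists>v. v \<in> closure (range A) \<and> (\<forall>h. cinner (B h) (A f) = cinner h (A v))" for f
    by (rule A_adjoint_bounded_defined[OF A B assms(10)[unfolded S], of f]) blast
  then obtain v where v: "\<And>f. v f \<in> closure (range A)"
    and Bv: "\<And>f h. cinner (B h) (A f) = cinner h (A (v f))"
    by metis
  have ABv: "cinner (A (B h)) f = cinner (A h) (v f)" for f h
    using Bv by (simp add: positive_op_symmetric[OF A])
  have "g \<in> range A" if g: "adjoint_op (T +\<^sub>o\<^sub>p S) (A f) = Some g" for f g
  proof -
    \<comment> \<open>Since \<open>A (v f)\<close> is the adjoint of \<open>S\<close> at
      \<open>A f\<close>, subtracting it leaves the adjoint of \<open>T\<close>, to which the range
      hypothesis on \<open>T\<close> applies.\<close>
    have "adjoint_op T (A f) = Some (g - A (v f))"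
      using g unfolding adjoint_op_eq_Some_iff[OF TS] adjoint_op_eq_Some_iff[OF assms(4)] dom
      by (simp add: add cinner_add_left cinner_diff_right Bv algebra_simps)
    then have "(adjoint_op T \<circ>\<^sub>m (Some \<circ> A)) f = Some (g - A (v f))" by simp
    then have "g - A (v f) \<in> ran (adjoint_op T \<circ>\<^sub>m (Some \<circ> A))" by (rule ranI)
    with assms(9) obtain u where "g - A (v f) = A u" by blast
    then have "g = A (u + v f)"
      by (simp add: bounded_clinear_add[OF A(1)] diff_eq_eq)
    then show ?thesis by simp
  qed
  then have "ran (adjoint_op (T +\<^sub>o\<^sub>p S) \<circ>\<^sub>m (Some \<circ> A)) \<subseteq> range A"
    by (auto simp: ran_def)
  then show "A_adjoint_exists A (T +\<^sub>o\<^sub>p S)"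
    using TS closable_op_add_bounded[OF assms(5) B] by (simp add: A_adjoint_exists_def S)
  \<comment> \<open>One extension is already known, so equality only needs this inclusion of
    domains. As the A-adjoint of \<open>S\<close> is total with values \<open>v f\<close>, the
    candidate for \<open>T\<close> is \<open>g - v f\<close>.\<close>
  have "f \<in> dom (A_adjoint A T +\<^sub>o\<^sub>p A_adjoint A S)"
    if g: "A_adjoint A (T +\<^sub>o\<^sub>p S) f = Some g" for f g
  proof -
    have Sv: "A_adjoint A S f = Some (v f)"
      unfolding A_adjoint_eq_Some_iff[OF A assms(7)]
      using v ABv by (simp add: S)
    have "A_adjoint A T f = Some (g - v f)"
      using g v complex_vector.subspace_diff[OF subspace_closure_range[OF A(1)]]
      unfolding A_adjoint_eq_Some_iff[OF A TS] A_adjoint_eq_Some_iff[OF A assms(4)] dom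
      by (simp add: add bounded_clinear_add[OF A(1)] cinner_add_left cinner_diff_right ABv
          eq_diff_eq)
    with Sv show ?thesis by auto
  qed
  then show "A_adjoint A (T +\<^sub>o\<^sub>p S) = A_adjoint A T +\<^sub>o\<^sub>p A_adjoint A S"
    using A_adjoint_op_add_le[OF A assms(4,7) TS]
    by (intro map_le_antisym) (auto simp: map_le_def)
qed

end
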